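(* Let $n$ be a positive integer. For $i=0,1,\dots,n$ let \[A_i=\Big\{(x_1,\dots,x_{n+1})\in\{0,\pm1,\dots,\pm(3n+1)\}^{n+1}:\ \sum_{j=1}^{n+1}2^{j-1}x_j=2^i\Big\}.\] Let $p(x_1,\dots,x_{n+1})$ be a real polynomial with sign $(-1)^i$ throughout $A_i$ and sign $(-1)^{i+1}$ throughout $-A_i=\{-x:x\in A_i\}$, for $i=0,1,\dots,n$. Then $\deg p\geq 2n+1$.
   Context: $\deg p$ is the total degree. *)

theory Defs
  imports Complex_Main "HOL-Library.Poly_Mapping"
begin

text \<open>
  Real multivariate polynomials are finitely supported maps from monomials to coefficients,
  where a monomial is a finitely supported map from variable indices to exponents.
\<close>

type_synonym real_mpoly = "(nat \<Rightarrow>\<^sub>0 nat) \<Rightarrow>\<^sub>0 real"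

definition vars :: "real_mpoly \<Rightarrow> nat set" where
  "vars p = (\<Union>m\<in>Poly_Mapping.keys p. Poly_Mapping.keys m)"

definition eval_mpoly :: "real_mpoly \<Rightarrow> (nat \<Rightarrow> real) \<Rightarrow> real" where
  "eval_mpoly p x =
     (\<Sum>m\<in>Poly_Mapping.keys p. Poly_Mapping.lookup p m *
        (\<Prod>j\<in>Poly_Mapping.keys m. x j ^ Poly_Mapping.lookup m j))"

definition monom_degree :: "(nat \<Rightarrow>\<^sub>0 nat) \<Rightarrow> nat" where
  "monom_degree m = (\<Sum>j\<in>Poly_Mapping.keys m. Poly_Mapping.lookup m j)"

text \<open>The zero polynomial has total degree 0.\<close>

definition total_degree :: "real_mpoly \<Rightarrow> nat" where
  "total_degree p = Max (insert 0 (monom_degree ` Poly_Mapping.keys p))"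

text \<open>
  A tuple \<open>(x\<^sub>1, \<dots>, x\<^sub>n\<^sub>+\<^sub>1)\<close> is a function that vanishes outside \<open>{1..n+1}\<close>.
\<close>

definition A :: "nat \<Rightarrow> nat \<Rightarrow> (nat \<Rightarrow> int) set" where
  "A n i = {x. (\<forall>j\<in>{1..n+1}. x j \<in> {- int (3*n+1) .. int (3*n+1)}) \<and>
               (\<forall>j. j \<notin> {1..n+1} \<longrightarrow> x j = 0) \<and>
               (\<Sum>j=1..n+1. 2 ^ (j-1) * x j) = 2 ^ i}"

end

theory Submission
  imports Defs "HOL-Computational_Algebra.Polynomial"
begin

text \<open>
  For \<open>t = \<plusminus>2\<^sup>i\<close> choose random integers \<open>K\<^sub>1, \<dots>, K\<^sub>n\<close>, independent, with \<open>K\<^sub>j\<close> distributed according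
  to the B-spline of order \<open>2n+1\<close> centred at \<open>t/2\<^sup>j\<close>, so that \<open>\<bar>K\<^sub>j - t/2\<^sup>j\<bar> \<le> n + 1/2\<close>.
  With \<open>K\<^sub>0 = t\<close> the point \<open>x\<close> given by \<open>x\<^sub>j = K\<^sub>j\<^sub>-\<^sub>1 - 2K\<^sub>j\<close> for \<open>j \<le> n\<close> and \<open>x\<^sub>n\<^sub>+\<^sub>1 = K\<^sub>n\<close>
  satisfies \<open>\<Sum>2\<^sup>j\<^sup>-\<^sup>1x\<^sub>j = t\<close> and \<open>\<bar>x\<^sub>j\<bar> \<le> 3n + 3/2\<close>, hence lies in \<open>\<plusminus>A\<^sub>i\<close>.
  B-splines of order \<open>2n+1\<close> reproduce polynomials of degree at most \<open>2n\<close>: the moment of order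
  \<open>a \<le> 2n\<close> of \<open>K\<^sub>j\<close> is a polynomial in \<open>t\<close> of degree at most \<open>a\<close>.  So if \<open>deg p \<le> 2n\<close>, then the expectation
  of \<open>p(x)\<close> is a univariate polynomial in \<open>t\<close> of degree at most \<open>2n\<close>, whose signs alternate on the
  \<open>2n+2\<close> points \<open>-2\<^sup>n, \<dots>, -1, 1, \<dots>, 2\<^sup>n\<close>, which is impossible.
\<close>

section \<open>Averaging over cardinal B-splines\<close>

text \<open>
  \<open>spline_avg m s f\<close> is \<open>\<Sum>k. B(s - k) f(k)\<close> for the cardinal B-spline \<open>B\<close> of order \<open>m + 1\<close>
  supported on \<open>[0, m + 1]\<close>; the equations are the Cox--de Boor recursion in dual form.
\<close>

primrec spline_avg :: "nat \<Rightarrow> real \<Rightarrow> (int \<Rightarrow> real) \<Rightarrow> real" where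
  "spline_avg 0 s f = f \<lfloor>s\<rfloor>"
| "spline_avg (Suc m) s f = spline_avg m s
     (\<lambda>k. ((s - of_int k) * f k + (real (Suc m) - s + of_int k) * f (k - 1)) / real (Suc m))"

lemma spline_avg_add:
  "spline_avg m s (\<lambda>k. f k + g k) = spline_avg m s f + spline_avg m s g"
proof (induction m arbitrary: f g)
  case (Suc m)
  show ?case
    unfolding spline_avg.simps Suc.IH[symmetric]
    by (intro arg_cong[where f = "spline_avg m s"] ext)
       (simp add: add_divide_distrib[symmetric] algebra_simps)
qed simp

lemma spline_avg_cmult: "spline_avg m s (\<lambda>k. c * f k) = c * spline_avg m s f"
proof (induction m arbitrary: f)
  case (Suc m)
  show ?case
    unfolding spline_avg.simps Suc.IH[symmetric]
    by (intro arg_cong[where f = "spline_avg m s"] ext) (simp add: algebra_simps)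
qed simp

text \<open>On the window of order \<open>m\<close> the weight of \<open>f k\<close> is nonnegative
  and that of \<open>f (k - 1)\<close> strictly positive, so the combined function satisfies the
  hypothesis one order lower.\<close>

lemma spline_avg_pos:
  assumes "\<And>k. s - real m - 1 < of_int k \<Longrightarrow> of_int k \<le> s \<Longrightarrow> f k > 0"
  shows "spline_avg m s f > 0"
  using assms
proof (induction m arbitrary: f)
  case 0
  show ?case
    using 0[of "\<lfloor>s\<rfloor>"] by simp
next
  case (Suc m)
  show ?case
    unfolding spline_avg.simps
  proof (rule Suc.IH)
    fix k :: int
    assume k: "s - real m - 1 < of_int k" "of_int k \<le> s"
    have "f k > 0" "f (k - 1) > 0"
      using k by (auto intro!: Suc.prems)
    moreover have "s - of_int k \<ge> 0" "real (Suc m) - s + of_int k > 0"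
      using k by auto
    ultimately show "((s - of_int k) * f k + (real (Suc m) - s + of_int k) * f (k - 1)) / real (Suc m) > 0"
      by (simp add: add_nonneg_pos del: of_nat_Suc)
  qed
qed

lemma spline_avg_one: "spline_avg m s (\<lambda>k. 1) = 1"
proof (induction m)
  case (Suc m)
  have "(\<lambda>k. ((s - of_int k) * 1 + (real (Suc m) - s + of_int k) * 1) / real (Suc m)) = (\<lambda>k::int. 1)"
    by (simp add: fun_eq_iff)
  then show ?case
    by (simp only: spline_avg.simps Suc.IH)
qed simp

text \<open>
  On rising factorials the recursion closes up; the last coefficient vanishes for \<open>a = m\<close>, which
  is why the spline of order \<open>m + 2\<close> handles degree \<open>m + 1\<close>.
\<close>

lemma spline_avg_pochhammer_Suc:
  "spline_avg (Suc m) s (\<lambda>k. pochhammer (of_int k) (Suc a)) =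
     (real (Suc a) * (s + real a) / real (Suc m) - real (Suc a)) * spline_avg m s (\<lambda>k. pochhammer (of_int k) a)
     + (1 - real (Suc a) / real (Suc m)) * spline_avg m s (\<lambda>k. pochhammer (of_int k) (Suc a))"
proof -
  have *: "((s - x) * pochhammer x (Suc a) + (real (Suc m) - s + x) * pochhammer (x - 1) (Suc a)) / real (Suc m)
      = (real (Suc a) * (s + real a) / real (Suc m) - real (Suc a)) * pochhammer x a
        + (1 - real (Suc a) / real (Suc m)) * pochhammer x (Suc a)" for x :: real
  proof -
    have 1: "pochhammer x (Suc a) = (x + real a) * pochhammer x a"
      by (simp add: pochhammer_rec')
    have 2: "pochhammer (x - 1) (Suc a) = (x - 1) * pochhammer x a"
      by (simp add: pochhammer_rec)
    show ?thesis
      unfolding 1 2 by (simp add: field_simps del: of_nat_Suc) (simp add: algebra_simps)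
  qed
  show ?thesis
    unfolding spline_avg.simps spline_avg_cmult[symmetric] spline_avg_add[symmetric]
    using *[of "of_int _"] by (simp del: of_nat_Suc)
qed

section \<open>Polynomial functions of bounded total degree\<close>

text \<open>Semantic counterpart of total degree at most \<open>d\<close>: averaging produces
  functions, not formal polynomials.\<close>

inductive polyfun :: "nat \<Rightarrow> ((nat \<Rightarrow> real) \<Rightarrow> real) \<Rightarrow> bool" where
  const: "polyfun d (\<lambda>x. c)"
| coord_mult: "polyfun d f \<Longrightarrow> polyfun (Suc d) (\<lambda>x. x i * f x)"
| add: "polyfun d f \<Longrightarrow> polyfun d g \<Longrightarrow> polyfun d (\<lambda>x. f x + g x)"

lemma polyfun_Suc: "polyfun d f \<Longrightarrow> polyfun (Suc d) f"
  by (induction rule: polyfun.induct) (auto intro: polyfun.intros)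

lemma polyfun_mono: "polyfun d f \<Longrightarrow> d \<le> e \<Longrightarrow> polyfun e f"
  by (rotate_tac, induction rule: dec_induct) (auto intro: polyfun_Suc)

lemma polyfun_cmult: "polyfun d f \<Longrightarrow> polyfun d (\<lambda>x. c * f x)"
proof (induction rule: polyfun.induct)
  case (coord_mult d f i)
  then show ?case
    using polyfun.coord_mult[of d "\<lambda>x. c * f x" i] by (simp add: mult.left_commute)
qed (auto simp: distrib_left intro: polyfun.intros)

lemma polyfun_mult: "polyfun d f \<Longrightarrow> polyfun e g \<Longrightarrow> polyfun (d + e) (\<lambda>x. f x * g x)"
proof (induction rule: polyfun.induct)
  case (const d c)
  then show ?case
    by (auto intro: polyfun_mono polyfun_cmult)
next
  case (coord_mult d f i)
  then show ?case
    using polyfun.coord_mult[of "d + e" "\<lambda>x. f x * g x" i] by (simp add: mult.assoc)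
qed (auto simp: distrib_right intro: polyfun.add)

lemma polyfun_coord: "polyfun 1 (\<lambda>x. x i)"
  using polyfun.coord_mult[OF polyfun.const[of 0 1], of i] by simp

lemma polyfun_sum:
  assumes "\<And>i. i \<in> I \<Longrightarrow> polyfun d (f i)"
  shows "polyfun d (\<lambda>x. \<Sum>i\<in>I. f i x)"
  using assms by (induction I rule: infinite_finite_induct) (auto intro: polyfun.intros)

lemma polyfun_power: "polyfun d f \<Longrightarrow> polyfun (a * d) (\<lambda>x. f x ^ a)"
  by (induction a) (auto intro: polyfun.const polyfun_mult)

lemma polyfun_prod:
  assumes "\<And>i. i \<in> I \<Longrightarrow> polyfun (e i) (f i)"
  shows "polyfun (\<Sum>i\<in>I. e i) (\<lambda>x. \<Prod>i\<in>I. f i x)"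
  using assms by (induction I rule: infinite_finite_induct) (auto intro: polyfun.const polyfun_mult)

lemma polyfun_eval_mpoly:
  assumes "\<And>j. polyfun 1 (\<lambda>y. X y j)"
  shows "polyfun (total_degree p) (\<lambda>y. eval_mpoly p (X y))"
  unfolding eval_mpoly_def
proof (intro polyfun_sum polyfun_cmult)
  fix m assume m: "m \<in> Poly_Mapping.keys p"
  have "monom_degree m \<le> total_degree p"
    unfolding total_degree_def using m by (intro Max_ge) auto
  moreover have "polyfun (monom_degree m)
      (\<lambda>y. \<Prod>j\<in>Poly_Mapping.keys m. X y j ^ Poly_Mapping.lookup m j)"
    unfolding monom_degree_def
    using polyfun_power[OF assms] by (intro polyfun_prod) auto
  ultimately show "polyfun (total_degree p)
      (\<lambda>y. \<Prod>j\<in>Poly_Mapping.keys m. X y j ^ Poly_Mapping.lookup m j)"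
    by (rule polyfun_mono[rotated])
qed

lemma polyfun_line:
  assumes "polyfun d f"
  shows "\<exists>q. degree q \<le> d \<and> (\<forall>t. f (\<lambda>j. t * u j) = poly q t)"
  using assms
proof (induction rule: polyfun.induct)
  case (const d c)
  show ?case
    by (rule exI[of _ "[:c:]"]) auto
next
  case (coord_mult d f i)
  then obtain q where q: "degree q \<le> d" "\<And>t. f (\<lambda>j. t * u j) = poly q t"
    by blast
  have "degree ([:0, u i:] * q) \<le> degree [:0, u i:] + degree q"
    by (rule degree_mult_le)
  also have "\<dots> \<le> Suc d"
    using q(1) by auto
  finally show ?case
    using q(2) by (intro exI[of _ "[:0, u i:] * q"]) (auto simp: algebra_simps)
next
  case (add d f g)
  then obtain q r where "degree q \<le> d" "\<And>t. f (\<lambda>j. t * u j) = poly q t"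
    "degree r \<le> d" "\<And>t. g (\<lambda>j. t * u j) = poly r t"
    by blast
  then show ?case
    by (intro exI[of _ "q + r"]) (auto intro: degree_add_le)
qed

text \<open>Expansion in coordinate \<open>i\<close> over the rising factorial basis, in which the
  spline recursion closes up; the coefficients \<open>G\<close> do not involve that
  coordinate.\<close>

inductive splitfun :: "nat \<Rightarrow> nat \<Rightarrow> ((nat \<Rightarrow> real) \<Rightarrow> real) \<Rightarrow> bool" for i where
  summand: "a + e \<le> d \<Longrightarrow> polyfun e G \<Longrightarrow> (\<And>x v. G (x(i := v)) = G x) \<Longrightarrow>
           splitfun i d (\<lambda>x. pochhammer (x i) a * G x)"
| add: "splitfun i d f \<Longrightarrow> splitfun i d g \<Longrightarrow> splitfun i d (\<lambda>x. f x + g x)"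

lemma splitfun_coord_mult:
  "splitfun i d f \<Longrightarrow> splitfun i (Suc d) (\<lambda>x. x j * f x)"
proof (induction rule: splitfun.induct)
  case (summand a e d G)
  show ?case
  proof (cases "j = i")
    case True
    \<comment> \<open>Uses \<open>v * pochhammer v a = pochhammer v (Suc a) - a * pochhammer v
      a\<close>.\<close>
    have "splitfun i (Suc d) (\<lambda>x. pochhammer (x i) (Suc a) * G x)"
      using summand by (intro splitfun.summand[of _ e]) auto
    moreover have "splitfun i (Suc d) (\<lambda>x. pochhammer (x i) a * (- real a * G x))"
      using summand by (intro splitfun.summand[of _ e] polyfun_cmult) auto
    ultimately have "splitfun i (Suc d) (\<lambda>x. pochhammer (x i) (Suc a) * G x
        + pochhammer (x i) a * (- real a * G x))"
      by (rule splitfun.add)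
    then show ?thesis
      using True by (simp add: pochhammer_rec' algebra_simps)
  next
    case False
    have "splitfun i (Suc d) (\<lambda>x. pochhammer (x i) a * (x j * G x))"
      using summand False by (intro splitfun.summand[of _ "Suc e"] polyfun.coord_mult) auto
    then show ?thesis
      by (simp add: mult.left_commute)
  qed
next
  case (add d f g)
  then show ?case
    by (auto simp: distrib_left intro: splitfun.add)
qed

lemma polyfun_imp_splitfun: "polyfun d f \<Longrightarrow> splitfun i d f"
proof (induction rule: polyfun.induct)
  case (const d c)
  show ?case
    using splitfun.summand[of 0 0 d "\<lambda>x. c" i] by (simp add: polyfun.const)
qed (auto intro: splitfun_coord_mult splitfun.add)

text \<open>In the recursion for the moments, lowering \<open>a\<close> by one costs one factor of
  degree at most 1 in \<open>S x\<close>.\<close>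

lemma polyfun_spline_avg_pochhammer:
  assumes "polyfun 1 S" "a \<le> m"
  shows "polyfun a (\<lambda>x. spline_avg m (S x) (\<lambda>k. pochhammer (of_int k) a))"
  using assms(2)
proof (induction m arbitrary: a)
  case 0
  then show ?case
    by (simp add: polyfun.const)
next
  case (Suc m)
  show ?case
  proof (cases a)
    case 0
    then show ?thesis
      by (simp add: spline_avg_one polyfun.const del: spline_avg.simps)
  next
    case (Suc b)
    have "polyfun 1 (\<lambda>x. (real (Suc b) / real (Suc m)) * (S x + real b) + - real (Suc b))"
      by (intro polyfun.add polyfun_cmult assms(1) polyfun.const)
    then have 1: "polyfun (1 + b) (\<lambda>x. ((real (Suc b) / real (Suc m)) * (S x + real b) + - real (Suc b))
        * spline_avg m (S x) (\<lambda>k. pochhammer (of_int k) b))"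
      using Suc.prems Suc by (intro polyfun_mult Suc.IH) auto
    have 2: "polyfun (1 + b) (\<lambda>x. (1 - real (Suc b) / real (Suc m))
        * spline_avg m (S x) (\<lambda>k. pochhammer (of_int k) (Suc b)))"
    proof (cases "b = m")
      case True
      then show ?thesis
        by (simp add: polyfun.const)
    next
      case False
      then have "Suc b \<le> m"
        using Suc.prems Suc by simp
      then show ?thesis
        using Suc.IH[of "Suc b"] by (intro polyfun_cmult) simp
    qed
    show ?thesis
      using polyfun.add[OF 1 2] unfolding Suc spline_avg_pochhammer_Suc
      by (simp add: diff_conv_add_uminus del: of_nat_Suc add_uminus_conv_diff)
  qed
qed

text \<open>In each summand of the split form \<open>G\<close> leaves the average as a constant, and
  the moment replacing the rising factorial has degree at most \<open>a\<close>.\<close>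

lemma polyfun_spline_avg:
  assumes "polyfun d F" "d \<le> m" "polyfun 1 S"
  shows "polyfun d (\<lambda>x. spline_avg m (S x) (\<lambda>k. F (x(i := of_int k))))"
  using polyfun_imp_splitfun[OF assms(1), of i] assms(2)
proof (induction rule: splitfun.induct)
  case (summand a e d G)
  have "polyfun (e + a) (\<lambda>x. G x * spline_avg m (S x) (\<lambda>k. pochhammer (of_int k) a))"
    using summand assms(3) by (intro polyfun_mult polyfun_spline_avg_pochhammer) auto
  then have "polyfun (e + a) (\<lambda>x. spline_avg m (S x) (\<lambda>k. pochhammer (of_int k) a * G x))"
    by (simp add: spline_avg_cmult[symmetric] mult.commute)
  then show ?case
    using summand(1) by (simp add: summand(3) fun_upd_same polyfun_mono del: fun_upd_apply)
qed (auto simp: spline_avg_add intro: polyfun.add)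

section \<open>Averaging over all coordinates\<close>

text \<open>Expectation over coordinates 1 to \<open>r\<close>. Coordinate 0, which will carry
  \<open>t\<close>, is never overwritten.\<close>

primrec iter_avg :: "nat \<Rightarrow> (nat \<Rightarrow> (nat \<Rightarrow> real) \<Rightarrow> real) \<Rightarrow> nat
    \<Rightarrow> ((nat \<Rightarrow> real) \<Rightarrow> real) \<Rightarrow> (nat \<Rightarrow> real) \<Rightarrow> real" where
  "iter_avg m S 0 F = F"
| "iter_avg m S (Suc r) F =
     (\<lambda>x. spline_avg m (S (Suc r) x) (\<lambda>k. iter_avg m S r F (x(Suc r := of_int k))))"

lemma polyfun_iter_avg:
  assumes "polyfun d F" "d \<le> m" "\<And>i. polyfun 1 (S i)"
  shows "polyfun d (iter_avg m S r F)"
  using assms by (induction r) (auto intro: polyfun_spline_avg)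

lemma iter_avg_cmult: "iter_avg m S r (\<lambda>x. c * F x) x = c * iter_avg m S r F x"
  by (induction r arbitrary: x) (simp_all add: spline_avg_cmult)

text \<open>Since \<open>S\<close> depends on coordinate 0 only, fixing one coordinate does not move
  the windows of the others.\<close>

lemma iter_avg_pos:
  assumes S: "\<And>i x y. x 0 = y 0 \<Longrightarrow> S i x = S i y"
    and F: "\<And>y. y 0 = x 0 \<Longrightarrow> (\<And>i. r < i \<Longrightarrow> y i = x i) \<Longrightarrow>
       (\<And>i. i \<in> {1..r} \<Longrightarrow> y i \<in> \<int> \<and> S i x - real m - 1 < y i \<and> y i \<le> S i x) \<Longrightarrow> F y > 0"
  shows "iter_avg m S r F x > 0"
  using F
proof (induction r arbitrary: x)
  case 0
  show ?case
    using 0[of x] by simp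
next
  case (Suc r)
  show ?case
    unfolding iter_avg.simps
  proof (rule spline_avg_pos)
    fix k :: int
    assume k: "S (Suc r) x - real m - 1 < of_int k" "of_int k \<le> S (Suc r) x"
    define x' where "x' = x(Suc r := of_int k)"
    have S': "S i x' = S i x" for i
      by (rule S) (simp add: x'_def)
    show "iter_avg m S r F (x(Suc r := of_int k)) > 0"
      unfolding x'_def[symmetric]
    proof (rule Suc.IH)
      fix y
      assume y: "y 0 = x' 0" "\<And>i. r < i \<Longrightarrow> y i = x' i"
        "\<And>i. i \<in> {1..r} \<Longrightarrow> y i \<in> \<int> \<and> S i x' - real m - 1 < y i \<and> y i \<le> S i x'"
      show "F y > 0"
      proof (rule Suc.prems)
        show "y i \<in> \<int> \<and> S i x - real m - 1 < y i \<and> y i \<le> S i x" if "i \<in> {1..Suc r}" for i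
          using that y(2)[of "Suc r"] y(3)[of i] k unfolding S'
          by (cases "i = Suc r") (auto simp: x'_def)
      qed (use y in \<open>auto simp: x'_def\<close>)
    qed
  qed
qed

section \<open>Alternating signs\<close>

text \<open>Each of the \<open>N\<close> gaps contains a root by the intermediate value theorem, and
  these roots are distinct.\<close>

lemma degree_ge_sign_alternations:
  fixes q :: "real poly" and z :: "nat \<Rightarrow> real"
  assumes mono: "\<And>k. k < N \<Longrightarrow> z k < z (Suc k)"
    and alt: "\<And>k. k < N \<Longrightarrow> poly q (z k) * poly q (z (Suc k)) < 0"
  shows "degree q \<ge> N"
proof (cases "N = 0")
  case False
  then have "q \<noteq> 0"
    using alt[of 0] by auto
  have "\<exists>r. z k < r \<and> r < z (Suc k) \<and> poly q r = 0" if "k < N" for k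
    using poly_IVT[OF mono alt, OF that that] by blast
  then obtain r where r: "\<And>k. k < N \<Longrightarrow> z k < r k \<and> r k < z (Suc k) \<and> poly q (r k) = 0"
    by metis
  have z_le: "z j \<le> z k" if "j \<le> k" "k \<le> N" for j k
    using that
  proof (induction rule: dec_induct)
    case (step k)
    then show ?case
      using mono[of k] by simp
  qed simp
  have less: "r j < r k" if "j < k" "k < N" for j k
    using r[of j] r[of k] z_le[of "Suc j" k] that by simp
  have "inj_on r {..<N}"
  proof (rule inj_onI)
    fix j k assume "j \<in> {..<N}" "k \<in> {..<N}" "r j = r k"
    then show "j = k"
      using less[of j k] less[of k j] by (cases j k rule: linorder_cases) auto
  qed
  then have "N = card (r ` {..<N})"
    by (simp add: card_image)
  also have "\<dots> \<le> card {x. poly q x = 0}"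
    using r poly_roots_finite[OF \<open>q \<noteq> 0\<close>] by (intro card_mono) auto
  also have "\<dots> \<le> degree q"
    by (rule card_poly_roots_bound[OF \<open>q \<noteq> 0\<close>])
  finally show ?thesis .
qed simp

lemma degree_ge_alternating_powers:
  fixes q :: "real poly"
  assumes pos: "\<And>i. i \<le> n \<Longrightarrow> sgn (poly q (2 ^ i)) = (-1) ^ i"
    and neg: "\<And>i. i \<le> n \<Longrightarrow> sgn (poly q (- (2 ^ i))) = (-1) ^ (i + 1)"
  shows "degree q \<ge> 2 * n + 1"
proof -
  \<comment> \<open>Lists \<open>- (2 ^ n), ..., -1, 1, ..., 2 ^ n\<close> in increasing
    order.\<close>
  define z :: "nat \<Rightarrow> real" where
    "z k = (if k \<le> n then - (2 ^ (n - k)) else 2 ^ (k - n - 1))" for k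
  have sgn_z: "sgn (poly q (z k)) = (-1) ^ (k + n + 1)" if "k \<le> 2 * n + 1" for k
  proof (cases "k \<le> n")
    case True
    then obtain j where "n = k + j"
      using le_Suc_ex by blast
    then show ?thesis
      using neg[of "n - k"] by (simp add: z_def minus_one_power_iff)
  next
    case False
    then obtain j where "k = n + 1 + j"
      using le_Suc_ex[of "n + 1" k] by auto
    then show ?thesis
      using pos[of "k - n - 1"] that by (simp add: z_def minus_one_power_iff)
  qed
  show ?thesis
  proof (rule degree_ge_sign_alternations[of _ z])
    fix k assume k: "k < 2 * n + 1"
    show "z k < z (Suc k)"
      by (cases k n rule: linorder_cases) (simp_all add: z_def)
    have "sgn (poly q (z k) * poly q (z (Suc k))) = (-1) ^ (k + n + 1) * (-1) ^ (Suc k + n + 1)"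
      using k by (simp only: sgn_mult sgn_z)
    also have "\<dots> = (-1 :: real)"
      by (simp add: minus_one_power_iff)
    finally show "poly q (z k) * poly q (z (Suc k)) < 0"
      by (simp only: sgn_1_neg)
  qed
qed

section \<open>The sets of the theorem\<close>

text \<open>Polymorphic because it serves both real arguments, for polynomiality, and integer
  points, for membership in the sets \<open>A n i\<close>.\<close>

definition digits :: "nat \<Rightarrow> (nat \<Rightarrow> 'a::comm_ring_1) \<Rightarrow> nat \<Rightarrow> 'a" where
  "digits n y j = (if j \<in> {1..n} then y (j - 1) - 2 * y j else if j = n + 1 then y n else 0)"

text \<open>The sum telescopes, and the last digit cancels the remainder
  \<open>- (2 ^ n * y n)\<close>.\<close>

lemma sum_digits: "(\<Sum>j=1..n+1. 2 ^ (j - 1) * digits n y j) = y 0"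
proof -
  have "(\<Sum>j=1..r. 2 ^ (j - 1) * digits n y j) = y 0 - 2 ^ r * y r" if "r \<le> n" for r
    using that by (induction r) (auto simp: digits_def algebra_simps)
  from this[of n] show ?thesis
    by (simp add: digits_def)
qed

lemma polyfun_digits: "polyfun 1 (\<lambda>y. digits n y j)"
proof -
  have *: "polyfun 1 (\<lambda>y. y (j - 1) + (-2) * y j)"
    by (intro polyfun.add polyfun_cmult polyfun_coord)
  consider "j \<in> {1..n}" | "j = n + 1" | "j \<notin> {1..n+1}"
    by fastforce
  then show ?thesis
  proof cases
    case 1
    then show ?thesis
      using * by (simp add: digits_def)
  next
    case 2
    then show ?thesis
      using polyfun_coord[of n] by (simp add: digits_def)
  next
    case 3
    then have "digits n y j = 0" for y :: "nat \<Rightarrow> real"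
      by (auto simp: digits_def)
    then show ?thesis
      by (simp add: polyfun.const)
  qed
qed

text \<open>The centres cancel in \<open>k (j - 1) - 2 * k j\<close>, leaving an error of at most
  3(n + 1/2) = 3n + 3/2; the last digit is at most 1 + (n + 1/2) in absolute value. Integrality
  lowers 3n + 3/2 to 3n + 1.\<close>

lemma digits_bounded:
  fixes k :: "nat \<Rightarrow> int" and t :: real
  assumes "n > 0" "j \<in> {1..n+1}" "k 0 = t" "\<bar>t\<bar> \<le> 2 ^ n"
    and k: "\<And>i. i \<in> {1..n} \<Longrightarrow> \<bar>k i - t / 2 ^ i\<bar> \<le> n + 1/2"
  shows "digits n k j \<in> {- int (3*n+1) .. int (3*n+1)}"
proof -
  have k': "\<bar>k i - t / 2 ^ i\<bar> \<le> n + 1/2" if "i \<le> n" for i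
    using k[of i] that assms(3) by (cases "i = 0") auto
  have "\<bar>of_int (digits n k j)\<bar> \<le> 3 * real n + 3/2"
  proof (cases "j = n + 1")
    case True
    have "\<bar>t / 2 ^ n\<bar> \<le> 1"
      using assms(4) by (simp add: abs_divide)
    then have "\<bar>of_int (k n)\<bar> \<le> real n + 3/2"
      using k'[of n] by linarith
    then show ?thesis
      using True by (simp add: digits_def)
  next
    case False
    then obtain i where i: "j = Suc i" "i < n"
      using assms(2) by (cases j) auto
    have "2 * (t / 2 ^ Suc i) = t / 2 ^ i"
      by simp
    then show ?thesis
      using k'[of i] k'[of "Suc i"] i by (simp add: digits_def)
  qed
  then show ?thesis
    by auto
qed

theorem theorem4p5:
  fixes n :: nat and p :: real_mpoly
  assumes "n > 0"
    and "vars p \<subseteq> {1..n+1}"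
    and "\<And>i x. i \<le> n \<Longrightarrow> x \<in> A n i \<Longrightarrow>
           sgn (eval_mpoly p (\<lambda>j. real_of_int (x j))) = (-1) ^ i"
    and "\<And>i x. i \<le> n \<Longrightarrow> x \<in> uminus ` A n i \<Longrightarrow>
           sgn (eval_mpoly p (\<lambda>j. real_of_int (x j))) = (-1) ^ (i + 1)"
  shows "total_degree p \<ge> 2 * n + 1"
proof (rule ccontr)
  assume "\<not> total_degree p \<ge> 2 * n + 1"
  then have deg: "total_degree p \<le> 2 * n"
    by simp
  define F where "F = (\<lambda>y. eval_mpoly p (digits n y))"
  \<comment> \<open>For \<open>m = 2 * n\<close> the window reaches from \<open>S - 2n - 1\<close>
    to \<open>S\<close>; the shift n + 1/2 centres it at \<open>x 0 / 2 ^ i\<close>.\<close>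
  define S :: "nat \<Rightarrow> (nat \<Rightarrow> real) \<Rightarrow> real" where
    "S = (\<lambda>i x. (1 / 2 ^ i) * x 0 + (real n + 1/2))"
  define u :: "nat \<Rightarrow> real" where "u = (\<lambda>j. if j = 0 then 1 else 0)"
  have "polyfun (total_degree p) F"
    unfolding F_def by (intro polyfun_eval_mpoly polyfun_digits)
  moreover have "polyfun 1 (S i)" for i
    unfolding S_def by (intro polyfun.add polyfun_cmult polyfun.const polyfun_coord)
  ultimately have "polyfun (total_degree p) (iter_avg (2 * n) S n F)"
    using deg by (intro polyfun_iter_avg)
  from polyfun_line[OF this, of u] obtain q where q: "degree q \<le> total_degree p"
    "\<And>t. iter_avg (2 * n) S n F (\<lambda>j. t * u j) = poly q t"
    by blast
  \<comment> \<open>Multiplying by the sign \<open>c\<close> reduces both signs to positivity of the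
    average.\<close>
  have sgn_q: "sgn (poly q t) = c"
    if c: "c \<in> {1, -1}" and t: "t = of_int t'" "\<bar>t\<bar> \<le> 2 ^ n"
      and sgn: "\<And>x. (\<forall>j\<in>{1..n+1}. x j \<in> {- int (3*n+1) .. int (3*n+1)}) \<Longrightarrow>
        (\<forall>j. j \<notin> {1..n+1} \<longrightarrow> x j = 0) \<Longrightarrow> (\<Sum>j=1..n+1. 2 ^ (j-1) * x j) = t' \<Longrightarrow>
        sgn (eval_mpoly p (\<lambda>j. real_of_int (x j))) = c" for c t t'
  proof -
    have "iter_avg (2 * n) S n (\<lambda>y. c * F y) (\<lambda>j. t * u j) > 0"
    proof (rule iter_avg_pos)
      fix y
      assume y: "y 0 = t * u 0" "\<And>i. n < i \<Longrightarrow> y i = t * u i"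
        "\<And>i. i \<in> {1..n} \<Longrightarrow> y i \<in> \<int> \<and> S i (\<lambda>j. t * u j) - real (2 * n) - 1 < y i \<and> y i \<le> S i (\<lambda>j. t * u j)"
      \<comment> \<open>All entries of \<open>y\<close> are integers, so the floor only changes the
        type.\<close>
      define k where "k = (\<lambda>i. \<lfloor>y i\<rfloor>)"
      have "y i \<in> \<int>" for i
        using y t(1) by (cases "i = 0"; cases "i \<le> n") (auto simp: u_def)
      then have yk: "y i = of_int (k i)" for i
        by (simp add: k_def)
      have k0: "of_int (k 0) = t"
        using y(1) by (simp add: u_def yk[symmetric])
      have "sgn (eval_mpoly p (\<lambda>j. real_of_int (digits n k j))) = c"
      proof (rule sgn)
        have "\<bar>k i - t / 2 ^ i\<bar> \<le> n + 1/2" if "i \<in> {1..n}" for i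
          using y(3)[OF that] unfolding yk S_def u_def by (simp add: abs_le_iff)
        then show "\<forall>j\<in>{1..n+1}. digits n k j \<in> {- int (3*n+1) .. int (3*n+1)}"
          by (intro ballI digits_bounded[OF assms(1) _ _ t(2)] k0)
        show "\<forall>j. j \<notin> {1..n+1} \<longrightarrow> digits n k j = 0"
          by (auto simp: digits_def)
        show "(\<Sum>j=1..n+1. 2 ^ (j-1) * digits n k j) = t'"
          unfolding sum_digits using k0 t(1) by simp
      qed
      moreover have "digits n y = (\<lambda>j. real_of_int (digits n k j))"
        by (auto simp: digits_def yk)
      ultimately show "c * F y > 0"
        using c by (auto simp: F_def sgn_if split: if_splits)
    qed (auto simp: S_def)
    then have "c * poly q t > 0"
      by (simp add: iter_avg_cmult q(2))
    then show ?thesis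
      using c by auto
  qed
  have "degree q \<ge> 2 * n + 1"
  proof (rule degree_ge_alternating_powers)
    fix i assume i: "i \<le> n"
    have c: "(-1) ^ j \<in> {1, -1 :: real}" for j
      by (cases "even j") auto
    show "sgn (poly q (2 ^ i)) = (-1) ^ i"
      using i by (intro sgn_q[OF c, of _ "2 ^ i"] assms(3)) (auto simp: A_def)
    show "sgn (poly q (- (2 ^ i))) = (-1) ^ (i + 1)"
    proof (rule sgn_q[OF c, of _ "- (2 ^ i)"])
      fix x :: "nat \<Rightarrow> int"
      assume x: "\<forall>j\<in>{1..n+1}. x j \<in> {- int (3*n+1) .. int (3*n+1)}"
        "\<forall>j. j \<notin> {1..n+1} \<longrightarrow> x j = 0" "(\<Sum>j=1..n+1. 2 ^ (j-1) * x j) = - (2 ^ i)"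
      have "(\<Sum>j=1..n+1. 2 ^ (j-1) * (- x) j) = 2 ^ i"
        using x(3) by (simp add: sum_negf)
      moreover have "(- x) j \<in> {- int (3*n+1) .. int (3*n+1)}" if "j \<in> {1..n+1}" for j
        using bspec[OF x(1) that] by auto
      ultimately have "- x \<in> A n i"
        using x(2) unfolding A_def by simp
      then have "x \<in> uminus ` A n i"
        by (rule rev_image_eqI) (simp add: fun_eq_iff)
      then show "sgn (eval_mpoly p (\<lambda>j. real_of_int (x j))) = (-1) ^ (i + 1)"
        by (rule assms(4)[OF i])
    qed (use i in auto)
  qed
  then show False
    using q(1) deg by simp
qed

end
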